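(* For each integer $q\ge 3$, $d_{\rm abs}(K_q)\ge q-1$.
   Context: A $K_q$-decomposition of a graph $G$ is a collection of pairwise edge-disjoint copies of $K_q$ in $G$ whose edge sets partition $E(G)$. A graph $G$ is $K_q$-divisible if $\binom q2\mid e(G)$ and $(q-1)\mid d(v)$ for every $v\in V(G)$. For a $K_q$-divisible graph $L$, a graph $A$ is a $K_q$-absorber for $L$ if $V(L)\subseteq V(A)$ is independent in $A$ and both $A$ and $L\cup A$ admit $K_q$-decompositions. For a graph $H$ and an independent set $R\subseteq V(H)$ of $H$, the maximum rooted density is $m(H,R):=\max\left\{\frac{e(H')}{|V(H')\setminus R|}: H'\subseteq H,\ V(H')\setminus R\neq\emptyset\right\}$. The maximum $2$-density is $m_2(H):=\max\left\{\frac{e(H')-1}{v(H')-2}: H'\subseteq H,\ v(H')\ge 3\right\}$, and the maximum rooted $2$-density is $m_2(H,R):=\max\{m(H,R),\,m_2(H)\}$. The $K_q$-absorber rooted $2$-density threshold $d_{\rm abs}(K_q)$ is the infimum over all positive reals $r$ such that for all positive integers $C_1$ there exists a positive integer $C_2$ such that for every $K_q$-divisible graph $L$ on at most $C_1$ vertices there exists a $K_q$-absorber $A$ of $L$ on at most $C_2$ vertices with $m_2(A,V(L))\le r$. *)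

theory Defs
  imports Complex_Main "HOL-Library.Extended_Real" "HOL-Library.Ramsey" "HOL-Library.Disjoint_Sets"
begin

text \<open>Finite simple graphs: an edge is a two-element set of vertices (\<open>nsets V 2\<close>, written
  \<open>[V]\<^bsup>2\<^esup>\<close>, is the set of all two-element subsets of \<open>V\<close>).\<close>

datatype 'a graph = Graph (verts: "'a set") (edges: "'a set set")

definition fin_graph :: "'a graph \<Rightarrow> bool" where
  "fin_graph G \<longleftrightarrow> finite (verts G) \<and> edges G \<subseteq> nsets (verts G) 2"

definition degree :: "'a graph \<Rightarrow> 'a \<Rightarrow> nat" where
  "degree G v = card {e \<in> edges G. v \<in> e}"

definition subgraph :: "'a graph \<Rightarrow> 'a graph \<Rightarrow> bool" where
  "subgraph H G \<longleftrightarrow> fin_graph H \<and> verts H \<subseteq> verts G \<and> edges H \<subseteq> edges G"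

definition graph_union :: "'a graph \<Rightarrow> 'a graph \<Rightarrow> 'a graph" where
  "graph_union G H = Graph (verts G \<union> verts H) (edges G \<union> edges H)"

definition independent_in :: "'a graph \<Rightarrow> 'a set \<Rightarrow> bool" where
  "independent_in G S \<longleftrightarrow> S \<subseteq> verts G \<and> edges G \<inter> nsets S 2 = {}"

definition clique_copy :: "nat \<Rightarrow> 'a graph \<Rightarrow> 'a graph \<Rightarrow> bool" where
  "clique_copy q G K \<longleftrightarrow>
     subgraph K G \<and> card (verts K) = q \<and> edges K = nsets (verts K) 2"

definition clique_decomposition :: "nat \<Rightarrow> 'a graph \<Rightarrow> 'a graph set \<Rightarrow> bool" where
  "clique_decomposition q G \<D> \<longleftrightarrow>
     (\<forall>K\<in>\<D>. clique_copy q G K) \<and> disjoint_family_on edges \<D> \<and> (\<Union>K\<in>\<D>. edges K) = edges G"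

definition clique_divisible :: "nat \<Rightarrow> 'a graph \<Rightarrow> bool" where
  "clique_divisible q G \<longleftrightarrow>
     (q choose 2) dvd card (edges G) \<and> (\<forall>v\<in>verts G. (q - 1) dvd degree G v)"

definition clique_absorber :: "nat \<Rightarrow> 'a graph \<Rightarrow> 'a graph \<Rightarrow> bool" where
  "clique_absorber q L A \<longleftrightarrow>
     fin_graph A \<and> independent_in A (verts L) \<and>
     (\<exists>\<D>. clique_decomposition q A \<D>) \<and>
     (\<exists>\<D>. clique_decomposition q (graph_union L A) \<D>)"

text \<open>A maximum over an empty family of subgraphs is taken to be \<open>0\<close>.
  Since every nonempty family in the rooted density contains an edgeless graph, the rooted density
  is always nonnegative, and the value \<open>0\<close> of \<open>max_2_density\<close> on a graph
  with at most two vertices does not affect \<open>max_rooted_2_density\<close>.\<close>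

definition max_rooted_density :: "'a graph \<Rightarrow> 'a set \<Rightarrow> real" where
  "max_rooted_density H R =
     (if verts H - R = {} then 0
      else Max {real (card (edges H')) / real (card (verts H' - R)) | H'.
                  subgraph H' H \<and> verts H' - R \<noteq> {}})"

definition max_2_density :: "'a graph \<Rightarrow> real" where
  "max_2_density H =
     (if card (verts H) < 3 then 0
      else Max {(real (card (edges H')) - 1) / (real (card (verts H')) - 2) | H'.
                  subgraph H' H \<and> card (verts H') \<ge> 3})"

definition max_rooted_2_density :: "'a graph \<Rightarrow> 'a set \<Rightarrow> real" where
  "max_rooted_2_density H R = max (max_rooted_density H R) (max_2_density H)"

text \<open>All graphs here are finite, so up to isomorphism their vertices may be taken to be natural
  numbers, of which there are always enough unused ones to build \<open>A\<close> around \<open>L\<close>.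
  The infimum is taken in the extended reals, where it is \<open>\<infinity>\<close> for an empty set.\<close>

definition d_abs :: "nat \<Rightarrow> ereal" where
  "d_abs q = Inf (ereal ` {r. r > 0 \<and>
     (\<forall>C1::nat. C1 > 0 \<longrightarrow> (\<exists>C2::nat. C2 > 0 \<and>
       (\<forall>L::nat graph. fin_graph L \<and> clique_divisible q L \<and> card (verts L) \<le> C1 \<longrightarrow>
         (\<exists>A. clique_absorber q L A \<and> card (verts A) \<le> C2 \<and>
              max_rooted_2_density A (verts L) \<le> r))))})"

end

theory Submission
  imports Defs
begin

text \<open>Let \<open>A\<close> absorb a graph \<open>L\<close> that has no \<open>K\<^sub>q\<close>-decomposition, and compare a decomposition of
  \<open>A\<close> with one of \<open>L \<union> A\<close>. Discarding the cliques that the two have in common leaves two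
  families without a common member that cover the same edges at every vertex outside \<open>L\<close>.
  If such a vertex \<open>v\<close> were in only one remaining clique of \<open>A\<close>, then its neighbourhood would
  determine that clique, and the other family would contain it too
  (\<open>in_two_cliques\<close>). Hence every covered vertex outside \<open>L\<close> has remaining degree at least
  \<open>2 (q - 1)\<close>, and by counting incidences the remaining graph has at least \<open>q - 1\<close> edges per
  vertex outside \<open>L\<close> (\<open>absorber_rooted_density\<close>). There is at least one such vertex: \<open>L\<close> is
  independent in \<open>A\<close>, so otherwise nothing of \<open>A\<close> would remain, and the cliques remaining on
  the other side would decompose \<open>L\<close>.

  This bounds the density of every absorber of \<open>L\<close>, whatever its order. It therefore suffices
  to have a single divisible graph without a decomposition, for every \<open>q\<close>. The complete
  bipartite graph with parts of size \<open>q (q - 1)\<close> is divisible, and it contains no triangle.\<close>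

section \<open>Cliques at a vertex\<close>

lemma fin_graph_finite_edges:
  assumes "fin_graph G"
  shows "finite (edges G)"
  using assms unfolding fin_graph_def by (meson finite_imp_finite_nsets finite_subset)

lemma pair_in_nsets:
  assumes "u \<in> S" "v \<in> S" "u \<noteq> v"
  shows "{u, v} \<in> nsets S 2"
  using assms by (auto simp: nsets_def)

lemma star_nsets:
  assumes "v \<in> S"
  shows "{e \<in> nsets S 2. v \<in> e} = (\<lambda>u. {v, u}) ` (S - {v})"
proof
  show "{e \<in> nsets S 2. v \<in> e} \<subseteq> (\<lambda>u. {v, u}) ` (S - {v})"
  proof
    fix e assume e: "e \<in> {e \<in> nsets S 2. v \<in> e}"
    then obtain x y where "e = {x, y}" "x \<noteq> y" "x \<in> S" "y \<in> S"
      by (auto simp: nsets_def card_2_iff)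
    with e show "e \<in> (\<lambda>u. {v, u}) ` (S - {v})" by auto
  qed
  show "(\<lambda>u. {v, u}) ` (S - {v}) \<subseteq> {e \<in> nsets S 2. v \<in> e}"
    using assms pair_in_nsets by fastforce
qed

lemma card_star_nsets:
  assumes "v \<in> S" "finite S"
  shows "card {e \<in> nsets S 2. v \<in> e} = card S - 1"
proof -
  have "inj_on (\<lambda>u. {v, u}) (S - {v})" by (auto simp: inj_on_def doubleton_eq_iff)
  then show ?thesis using assms by (simp add: star_nsets card_image)
qed

lemma ex_pair_at:
  assumes "v \<in> S" "card S \<ge> 2"
  obtains u where "u \<in> S" "u \<noteq> v"
proof -
  have "\<not> S \<subseteq> {v}" using assms(2) card_mono[of "{v}" S] by auto
  then show ?thesis using that by blast
qed

text \<open>If \<open>K\<close> were the only member of \<open>\<F>1\<close> at \<open>v\<close>, every edge of \<open>\<Union>(edges ` \<F>1)\<close> at \<open>v\<close> would lie in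
  \<open>K\<close>. A member \<open>M\<close> of \<open>\<F>2\<close> at \<open>v\<close> has all its edges at \<open>v\<close> among these, so every vertex of \<open>M\<close>
  belongs to \<open>K\<close>. Both have \<open>q\<close> vertices, so \<open>M = K\<close> would be a common member.\<close>

lemma in_two_cliques:
  assumes q: "q \<ge> 2"
    and copy1: "\<forall>K\<in>\<F>1. clique_copy q G1 K" and copy2: "\<forall>K\<in>\<F>2. clique_copy q G2 K"
    and disj: "\<F>1 \<inter> \<F>2 = {}"
    and same_star: "{e \<in> \<Union>(edges ` \<F>1). v \<in> e} = {e \<in> \<Union>(edges ` \<F>2). v \<in> e}"
    and K: "K \<in> \<F>1" "v \<in> verts K"
  shows "\<exists>K'\<in>\<F>1. K' \<noteq> K \<and> v \<in> verts K'"
proof (rule ccontr)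
  assume "\<not> ?thesis"
  then have only: "K' = K" if "K' \<in> \<F>1" "v \<in> verts K'" for K' using that by blast
  have cK: "card (verts K) = q" "edges K = nsets (verts K) 2"
    using copy1 K by (auto simp: clique_copy_def)
  obtain u where u: "u \<in> verts K" "u \<noteq> v" using ex_pair_at[of v "verts K"] K cK q by auto
  have "{u, v} \<in> edges K" using pair_in_nsets u K cK by metis
  then have "{u, v} \<in> {e \<in> \<Union>(edges ` \<F>2). v \<in> e}" using same_star K by blast
  then obtain M where M: "M \<in> \<F>2" "{u, v} \<in> edges M" by blast
  have cM: "card (verts M) = q" "edges M = nsets (verts M) 2"
    using copy2 M by (auto simp: clique_copy_def)
  have vM: "v \<in> verts M" using M cM by (auto simp: nsets_def)
  have "verts M \<subseteq> verts K"
  proof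
    fix w assume w: "w \<in> verts M"
    show "w \<in> verts K"
    proof (cases "w = v")
      case False
      then have "{w, v} \<in> edges M" using pair_in_nsets w vM cM by metis
      then have "{w, v} \<in> {e \<in> \<Union>(edges ` \<F>1). v \<in> e}" using same_star M by blast
      then obtain K' where K': "K' \<in> \<F>1" "{w, v} \<in> edges K'" by blast
      then have sub: "{w, v} \<subseteq> verts K'"
        using copy1 by (auto simp: clique_copy_def nsets_def)
      then have "K' = K" using only K' by blast
      then show ?thesis using sub by blast
    qed (use K in simp)
  qed
  moreover have "finite (verts K)" using cK q by (metis card.infinite not_numeral_le_zero)
  ultimately have "verts M = verts K" using cK cM by (metis card_subset_eq)
  then have "M = K" using cK cM by (metis graph.expand)
  then show False using M K disj by blast
qed

section \<open>Density of absorbers\<close>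

lemma le_max_rooted_density:
  assumes H: "fin_graph H" and sub: "subgraph H' H" and ne: "verts H' - R \<noteq> {}"
  shows "real (card (edges H')) / real (card (verts H' - R)) \<le> max_rooted_density H R"
proof -
  let ?f = "\<lambda>H'. real (card (edges H')) / real (card (verts H' - R))"
  let ?T = "{?f H' | H'. subgraph H' H \<and> verts H' - R \<noteq> {}}"
  have "?T \<subseteq> (\<lambda>(V, E). ?f (Graph V E)) ` (Pow (verts H) \<times> Pow (edges H))"
  proof
    fix x assume "x \<in> ?T"
    then obtain H' where H': "x = ?f H'" "subgraph H' H" by blast
    then have "(verts H', edges H') \<in> Pow (verts H) \<times> Pow (edges H)" by (simp add: subgraph_def)
    with H' show "x \<in> (\<lambda>(V, E). ?f (Graph V E)) ` (Pow (verts H) \<times> Pow (edges H))"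
      by (intro image_eqI[of _ _ "(verts H', edges H')"]) auto
  qed
  moreover have "finite (Pow (verts H) \<times> Pow (edges H))"
    using H fin_graph_finite_edges by (auto simp: fin_graph_def)
  ultimately have "finite ?T" by (meson finite_imageI finite_subset)
  moreover have "?f H' \<in> ?T" using sub ne by blast
  ultimately have "?f H' \<le> Max ?T" by (rule Max_ge)
  moreover have "verts H - R \<noteq> {}" using sub ne by (auto simp: subgraph_def)
  ultimately show ?thesis unfolding max_rooted_density_def by auto
qed

lemma edges_of_remaining_cliques:
  assumes "disjoint_family_on edges \<D>" "\<C> \<subseteq> \<D>"
  shows "\<Union>(edges ` (\<D> - \<C>)) = \<Union>(edges ` \<D>) - \<Union>(edges ` \<C>)"
proof -
  have "e \<notin> edges M" if "K \<in> \<D> - \<C>" "e \<in> edges K" "M \<in> \<C>" for e K M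
  proof -
    have "K \<noteq> M" "K \<in> \<D>" "M \<in> \<D>" using that assms(2) by auto
    then show ?thesis using assms(1) that(2) unfolding disjoint_family_on_def by blast
  qed
  then show ?thesis by auto
qed

text \<open>An edge is counted at most twice when the degrees over \<open>W\<close> are added up, namely once for each
  of its ends in \<open>W\<close>. The factor \<open>2\<close> in the degree bound pays for this.\<close>

lemma degree_sum_le:
  assumes "finite W" "finite E" "\<And>e. e \<in> E \<Longrightarrow> card e = 2"
    and deg: "\<And>v. v \<in> W \<Longrightarrow> 2 * d \<le> card {e \<in> E. v \<in> e}"
  shows "d * card W \<le> card E"
proof -
  have "2 * d * card W = (\<Sum>v\<in>W. 2 * d)" by simp
  also have "\<dots> \<le> (\<Sum>v\<in>W. card {e \<in> E. v \<in> e})" using deg by (intro sum_mono) auto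
  also have "\<dots> = (\<Sum>e\<in>E. card {v \<in> W. v \<in> e})"
    using assms(1,2) by (intro sum_multicount_gen) auto
  also have "\<dots> \<le> (\<Sum>e\<in>E. 2)"
  proof (rule sum_mono)
    fix e assume "e \<in> E"
    then have "card e = 2" "finite e" using assms(3) by (auto intro: card_ge_0_finite)
    then show "card {v \<in> W. v \<in> e} \<le> 2" using card_mono[of e "{v \<in> W. v \<in> e}"] by auto
  qed
  finally show ?thesis by simp
qed

text \<open>The dense subgraph of \<open>A\<close> consists of the edges \<open>E\<close> of the cliques used for \<open>A\<close> but not for
  \<open>L \<union> A\<close>; \<open>W\<close> is the set of its non-isolated vertices outside \<open>L\<close>. As no edge of \<open>L\<close> meets
  \<open>W\<close>, the two decompositions cover the same edges at each vertex of \<open>W\<close>, and two remaining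
  cliques, which are edge-disjoint, contribute \<open>q - 1\<close> edges each to its degree.\<close>

lemma absorber_rooted_density:
  fixes L A :: "'a graph"
  assumes q: "q \<ge> 2" and L: "fin_graph L" and abs: "clique_absorber q L A"
    and nodec: "\<nexists>\<D>. clique_decomposition q L \<D>"
  shows "real q - 1 \<le> max_rooted_density A (verts L)"
proof -
  have A: "fin_graph A" and indep: "verts L \<subseteq> verts A" "edges A \<inter> nsets (verts L) 2 = {}"
    using abs by (auto simp: clique_absorber_def independent_in_def)
  obtain \<D>1 \<D>2 where D1: "clique_decomposition q A \<D>1"
    and D2: "clique_decomposition q (graph_union L A) \<D>2"
    using abs by (auto simp: clique_absorber_def)
  define \<C> where "\<C> = \<D>1 \<inter> \<D>2"
  define \<F>1 where "\<F>1 = \<D>1 - \<C>"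
  define \<F>2 where "\<F>2 = \<D>2 - \<C>"
  define E where "E = \<Union>(edges ` \<F>1)"
  define W where "W = \<Union>(verts ` \<F>1) - verts L"
  have copy1: "\<forall>K\<in>\<F>1. clique_copy q A K" and disj1: "disjoint_family_on edges \<F>1"
    and copy2: "\<forall>K\<in>\<F>2. clique_copy q (graph_union L A) K" and disj2: "disjoint_family_on edges \<F>2"
    using D1 D2 by (auto simp: clique_decomposition_def \<F>1_def \<F>2_def disjoint_family_on_def)
  have E1: "E = edges A - \<Union>(edges ` \<C>)"
    unfolding E_def \<F>1_def
    using D1 by (subst edges_of_remaining_cliques) (auto simp: clique_decomposition_def \<C>_def)
  have E2: "\<Union>(edges ` \<F>2) = (edges L \<union> edges A) - \<Union>(edges ` \<C>)"
    unfolding \<F>2_def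
    using D2 by (subst edges_of_remaining_cliques)
      (auto simp: clique_decomposition_def \<C>_def graph_union_def)
  have CA: "\<Union>(edges ` \<C>) \<subseteq> edges A"
    using D1 by (auto simp: clique_decomposition_def \<C>_def)
  have Lsub: "edges L \<subseteq> nsets (verts L) 2" using L by (simp add: fin_graph_def)
  have LA: "edges L \<inter> edges A = {}" using Lsub indep(2) by (metis Int_commute disjoint_iff subsetD)
  have EA: "E \<subseteq> edges A" using E1 by blast
  have E_nsets: "E \<subseteq> nsets (verts L \<union> W) 2"
  proof
    fix e assume "e \<in> E"
    then obtain K where K: "K \<in> \<F>1" "e \<in> edges K" by (auto simp: E_def)
    then have "e \<in> nsets (verts K) 2" using copy1 by (auto simp: clique_copy_def)
    moreover have "verts K \<subseteq> verts L \<union> W" using K by (auto simp: W_def)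
    ultimately show "e \<in> nsets (verts L \<union> W) 2" using nsets_mono by blast
  qed
  have WA: "W \<subseteq> verts A - verts L"
    using copy1 by (auto simp: W_def clique_copy_def subgraph_def)
  have finA: "finite (verts A)" using A by (simp add: fin_graph_def)
  have finW: "finite W" using WA finA by (meson finite_Diff finite_subset)
  have finE: "finite E" using EA fin_graph_finite_edges[OF A] finite_subset by blast
  have Wne: "W \<noteq> {}"
  proof
    assume "W = {}"
    then have "E = {}" using E_nsets EA indep by auto
    \<comment> \<open>The edges of \<open>A\<close> are then exactly those of the common cliques, so the rest of the second
      decomposition covers precisely the edges of \<open>L\<close>.\<close>
    then have "\<Union>(edges ` \<C>) = edges A" using E1 CA by blast
    then have F2L: "\<Union>(edges ` \<F>2) = edges L" using E2 LA by (simp add: Un_Diff Diff_triv)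
    have "clique_copy q L K" if K: "K \<in> \<F>2" for K
    proof -
      have c: "card (verts K) = q" "edges K = nsets (verts K) 2" "fin_graph K"
        using copy2 K by (auto simp: clique_copy_def subgraph_def)
      have eL: "edges K \<subseteq> edges L" using F2L K by blast
      have "verts K \<subseteq> verts L"
      proof
        fix v assume v: "v \<in> verts K"
        then obtain u where u: "u \<in> verts K" "u \<noteq> v" using ex_pair_at[of v "verts K"] c q by auto
        then have "{u, v} \<in> edges K" using pair_in_nsets v c by metis
        then have "{u, v} \<in> nsets (verts L) 2" using eL Lsub by blast
        then show "v \<in> verts L" by (auto simp: nsets_def)
      qed
      then show ?thesis using c eL by (simp add: clique_copy_def subgraph_def)
    qed
    then have "clique_decomposition q L \<F>2"
      using disj2 F2L by (auto simp: clique_decomposition_def)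
    then show False using nodec by blast
  qed
  have deg: "2 * (q - 1) \<le> card {e \<in> E. v \<in> e}" if v: "v \<in> W" for v
  proof -
    obtain K where K: "K \<in> \<F>1" "v \<in> verts K" using v by (auto simp: W_def)
    have "e \<notin> edges L" if "v \<in> e" for e
      using that v Lsub by (auto simp: W_def nsets_def)
    then have "{e \<in> \<Union>(edges ` \<F>1). v \<in> e} = {e \<in> \<Union>(edges ` \<F>2). v \<in> e}"
      unfolding E2 E1[unfolded E_def] by blast
    then obtain M where M: "M \<in> \<F>1" "M \<noteq> K" "v \<in> verts M"
      using in_two_cliques[OF q copy1 copy2 _ _ K] by (auto simp: \<F>1_def \<F>2_def \<C>_def)
    have c: "card {e \<in> edges N. v \<in> e} = q - 1" if "N \<in> \<F>1" "v \<in> verts N" for N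
    proof -
      have "card (verts N) = q" "edges N = nsets (verts N) 2" "finite (verts N)"
        using copy1 that by (auto simp: clique_copy_def subgraph_def fin_graph_def)
      then show ?thesis using card_star_nsets that by metis
    qed
    have fin: "finite {e \<in> edges N. v \<in> e}" if "N \<in> \<F>1" for N
      using that finE by (auto simp: E_def intro: finite_subset)
    have "{e \<in> edges K. v \<in> e} \<inter> {e \<in> edges M. v \<in> e} = {}"
      using disj1 K M unfolding disjoint_family_on_def by blast
    then have "2 * (q - 1) = card ({e \<in> edges K. v \<in> e} \<union> {e \<in> edges M. v \<in> e})"
      using c K M fin by (simp add: card_Un_disjoint)
    also have "\<dots> \<le> card {e \<in> E. v \<in> e}"
    proof (rule card_mono)
      show "finite {e \<in> E. v \<in> e}" using finE by simp
    qed (use K M in \<open>auto simp: E_def\<close>)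
    finally show ?thesis .
  qed
  have "(q - 1) * card W \<le> card E"
    using finW finE deg E_nsets by (intro degree_sum_le) (auto simp: nsets_def)
  then have "real (q - 1) * real (card W) \<le> real (card E)" by (metis of_nat_le_iff of_nat_mult)
  moreover have "real (card W) > 0" using Wne finW by (simp add: card_gt_0_iff)
  ultimately have ratio: "real q - 1 \<le> real (card E) / real (card W)"
    using q by (simp add: pos_le_divide_eq)
  define H where "H = Graph (verts L \<union> W) E"
  have "subgraph H A"
  proof -
    have "finite (verts L \<union> W)" using L finW by (simp add: fin_graph_def)
    moreover have "verts L \<union> W \<subseteq> verts A" using WA indep(1) by blast
    ultimately show ?thesis using E_nsets EA by (simp add: H_def subgraph_def fin_graph_def)
  qed
  moreover have HW: "verts H - verts L = W" by (auto simp: H_def W_def)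
  ultimately have "real (card (edges H)) / real (card W) \<le> max_rooted_density A (verts L)"
    using le_max_rooted_density[OF A] Wne by metis
  then show ?thesis using ratio by (simp add: H_def)
qed

section \<open>A divisible graph without a decomposition\<close>

definition complete_bipartite :: "'a set \<Rightarrow> 'a set \<Rightarrow> 'a graph" where
  "complete_bipartite X Y = Graph (X \<union> Y) ((\<lambda>(x, y). {x, y}) ` (X \<times> Y))"

lemma fin_graph_complete_bipartite:
  assumes "finite X" "finite Y" "X \<inter> Y = {}"
  shows "fin_graph (complete_bipartite X Y)"
proof -
  have "{x, y} \<in> nsets (X \<union> Y) 2" if "x \<in> X" "y \<in> Y" for x y
    by (rule pair_in_nsets) (use that assms(3) in blast)+
  then have "edges (complete_bipartite X Y) \<subseteq> nsets (X \<union> Y) 2"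
    unfolding complete_bipartite_def by auto
  then show ?thesis using assms by (simp add: fin_graph_def complete_bipartite_def)
qed

lemma card_edges_complete_bipartite:
  assumes "X \<inter> Y = {}"
  shows "card (edges (complete_bipartite X Y)) = card X * card Y"
proof -
  have "inj_on (\<lambda>(x, y). {x, y}) (X \<times> Y)"
    using assms by (auto simp: inj_on_def doubleton_eq_iff)
  then show ?thesis by (simp add: complete_bipartite_def card_image card_cartesian_product)
qed

lemma degree_complete_bipartite_left:
  assumes "X \<inter> Y = {}" "v \<in> X"
  shows "degree (complete_bipartite X Y) v = card Y"
proof -
  have "{e \<in> edges (complete_bipartite X Y). v \<in> e} = (\<lambda>y. {v, y}) ` Y"
    using assms by (auto simp: complete_bipartite_def)
  moreover have "inj_on (\<lambda>y. {v, y}) Y" by (auto simp: inj_on_def doubleton_eq_iff)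
  ultimately show ?thesis by (simp add: degree_def card_image)
qed

lemma complete_bipartite_commute: "complete_bipartite X Y = complete_bipartite Y X"
proof -
  have "(\<lambda>(x, y). {x, y}) ` (X \<times> Y) \<subseteq> (\<lambda>(x, y). {x, y}) ` (Y \<times> X)" for X Y :: "'a set"
  proof
    fix e assume "e \<in> (\<lambda>(x, y). {x, y}) ` (X \<times> Y)"
    then obtain x y where "e = {y, x}" "x \<in> X" "y \<in> Y" by auto
    then show "e \<in> (\<lambda>(x, y). {x, y}) ` (Y \<times> X)" by (intro image_eqI[of _ _ "(y, x)"]) auto
  qed
  then show ?thesis unfolding complete_bipartite_def by (simp add: Un_commute subset_antisym)
qed

lemma complete_bipartite_no_clique:
  assumes "X \<inter> Y = {}" "q \<ge> 3"
  shows "\<not> clique_copy q (complete_bipartite X Y) K"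
proof
  assume K: "clique_copy q (complete_bipartite X Y) K"
  then have "3 \<le> card (verts K)" using assms by (simp add: clique_copy_def)
  then obtain T where "T \<subseteq> verts K" "card T = 3" by (meson obtain_subset_with_card_n)
  then obtain a b c where abc: "{a, b, c} \<subseteq> verts K" "a \<noteq> b" "a \<noteq> c" "b \<noteq> c"
    by (auto simp: card_3_iff)
  have sub: "{u, v} \<in> (\<lambda>(x, y). {x, y}) ` (X \<times> Y)" if "u \<in> verts K" "v \<in> verts K" "u \<noteq> v" for u v
  proof -
    have "{u, v} \<in> edges K" using K that pair_in_nsets by (metis clique_copy_def)
    then show ?thesis using K by (auto simp: clique_copy_def subgraph_def complete_bipartite_def)
  qed
  have cross: "(u \<in> X \<and> v \<in> Y) \<or> (u \<in> Y \<and> v \<in> X)"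
    if "u \<in> verts K" "v \<in> verts K" "u \<noteq> v" for u v
    using sub[OF that] by (auto simp: doubleton_eq_iff)
  show False using cross[of a b] cross[of a c] cross[of b c] abc assms(1) by auto
qed

text \<open>With parts of size \<open>m = q (q - 1)\<close>, the \<open>m\<close>-regular graph with \<open>m\<^sup>2\<close> edges meets both
  divisibility conditions, since \<open>q - 1\<close> and \<open>q choose 2 = m / 2\<close> divide \<open>m\<close>. It has edges, but no
  clique to cover them.\<close>

lemma divisible_without_decomposition:
  fixes q :: nat
  assumes q: "q \<ge> 3"
  shows "\<exists>L::nat graph. fin_graph L \<and> clique_divisible q L \<and> (\<nexists>\<D>. clique_decomposition q L \<D>)"
proof -
  define m where "m = q * (q - 1)"
  define X where "X = {0..<m}"
  define Y where "Y = {m..<2 * m}"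
  define L where "L = complete_bipartite X Y"
  have XY: "X \<inter> Y = {}" "finite X" "finite Y" "card X = m" "card Y = m"
    by (auto simp: X_def Y_def)
  have m: "m > 0" using q by (simp add: m_def)
  have cardE: "card (edges L) = m * m"
    using card_edges_complete_bipartite XY by (metis L_def)
  have "even m" using q by (cases "even q") (simp_all add: m_def)
  then have "m = (q choose 2) * 2" by (simp add: choose_two m_def)
  then have "(q choose 2) dvd m" by (rule dvdI)
  then have "(q choose 2) dvd card (edges L)" by (simp add: cardE)
  moreover have "degree L v = m" if "v \<in> verts L" for v
  proof (cases "v \<in> X")
    case True
    then show ?thesis using degree_complete_bipartite_left XY by (metis L_def)
  next
    case False
    then have "v \<in> Y" using that by (simp add: L_def complete_bipartite_def)
    then have "degree (complete_bipartite Y X) v = card X"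
      using XY by (intro degree_complete_bipartite_left) auto
    then show ?thesis using XY by (simp add: L_def complete_bipartite_commute)
  qed
  ultimately have "clique_divisible q L" by (simp add: clique_divisible_def m_def)
  moreover have "fin_graph L" using fin_graph_complete_bipartite XY by (metis L_def)
  moreover have "\<nexists>\<D>. clique_decomposition q L \<D>"
  proof
    assume "\<exists>\<D>. clique_decomposition q L \<D>"
    then obtain \<D> where D: "clique_decomposition q L \<D>" by blast
    then have "\<D> = {}"
      using complete_bipartite_no_clique[OF XY(1) q] by (auto simp: clique_decomposition_def L_def)
    then have "edges L = {}" using D by (simp add: clique_decomposition_def)
    then show False using cardE m by simp
  qed
  ultimately show ?thesis by blast
qed

section \<open>The lower bound\<close>

theorem corollary11p2:
  fixes q :: nat
  assumes "q \<ge> 3"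
  shows "d_abs q \<ge> ereal (real q - 1)"
proof -
  obtain L :: "nat graph" where L: "fin_graph L" "clique_divisible q L"
    and nodec: "\<nexists>\<D>. clique_decomposition q L \<D>"
    using divisible_without_decomposition[OF assms] by blast
  have "real q - 1 \<le> r"
    if r: "\<forall>C1::nat. C1 > 0 \<longrightarrow> (\<exists>C2::nat. C2 > 0 \<and>
       (\<forall>L::nat graph. fin_graph L \<and> clique_divisible q L \<and> card (verts L) \<le> C1 \<longrightarrow>
         (\<exists>A. clique_absorber q L A \<and> card (verts A) \<le> C2 \<and>
              max_rooted_2_density A (verts L) \<le> r)))" for r
  proof -
    \<comment> \<open>The successor makes the bound on the order of \<open>L\<close> positive.\<close>
    obtain A where A: "clique_absorber q L A" "max_rooted_2_density A (verts L) \<le> r"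
      using r[rule_format, of "Suc (card (verts L))"] L by (auto simp: le_Suc_eq)
    have "real q - 1 \<le> max_rooted_density A (verts L)"
      using assms by (intro absorber_rooted_density L A nodec) auto
    then show ?thesis using A by (simp add: max_rooted_2_density_def)
  qed
  then show ?thesis unfolding d_abs_def by (intro Inf_greatest) auto
qed

end
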